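(* Let $\nu\ge1$ be an integer. Then, as formal power series in $q$, \[ \sum_{n=0}^{\infty}N_\nu(n)q^n=q^{\nu(\nu-1)/2}\sum_{\tau=0}^{\infty}\frac{q^{\tau(\nu+\tau)}}{(q;q)_\tau\,(q;q)_{\nu+\tau-1}}. \]
   Context: Notation: $(x;q)_n=\prod_{k=0}^{n-1}(1-xq^k)$. Definition of $N_\nu(n)$ (for $\nu\ge1$, $n\ge0$): for a partition $\lambda_1\ge\dots\ge\lambda_k$ of $n$, its $\nu$-Durfee rectangle is the largest rectangle of height $t$ and width $t+\nu$ fitting in its Young diagram, i.e. $t$ is the largest integer $0\le t\le k$ with $\lambda_t\ge t+\nu$ ($t=0$ always allowed). $N_\nu(n)$ is the number of partitions of $n$ such that each of $1,2,\dots,\nu-1$ occurs as a part at least once and every part below the $\nu$-Durfee rectangle is strictly less than its width, i.e. $\lambda_i<t+\nu$ for all $i>t$. *)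

theory Defs
  imports "HOL-Computational_Algebra.Formal_Power_Series"
begin

definition q_pochhammer :: "'a::comm_ring_1 \<Rightarrow> 'a \<Rightarrow> nat \<Rightarrow> 'a" where
  "q_pochhammer x q n = (\<Prod>k<n. 1 - x * q ^ k)"

text \<open>A partition is the weakly decreasing list of its positive parts; lists are indexed
  from 0, so the part \<open>\<lambda>\<^sub>i\<close> is \<open>xs ! (i - 1)\<close>.\<close>

definition is_partition_of :: "nat list \<Rightarrow> nat \<Rightarrow> bool" where
  "is_partition_of xs n \<longleftrightarrow>
     sorted_wrt (\<ge>) xs \<and> (\<forall>x\<in>set xs. 0 < x) \<and> sum_list xs = n"

definition durfee_height :: "nat \<Rightarrow> nat list \<Rightarrow> nat" where
  "durfee_height \<nu> xs =
     Max {t. t \<le> length xs \<and> (t = 0 \<or> t + \<nu> \<le> xs ! (t - 1))}"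

text \<open>The indices \<open>i > t\<close> (counted from 1) of the parts below the rectangle are the list
  positions \<open>t, \<dots>, length xs - 1\<close>.\<close>

definition N_durfee :: "nat \<Rightarrow> nat \<Rightarrow> nat" where
  "N_durfee \<nu> n = card {xs. is_partition_of xs n \<and>
     (\<forall>j. 1 \<le> j \<and> j < \<nu> \<longrightarrow> j \<in> set xs) \<and>
     (\<forall>i. durfee_height \<nu> xs \<le> i \<and> i < length xs \<longrightarrow> xs ! i < durfee_height \<nu> xs + \<nu>)}"

end

theory Submission
  imports Defs
begin

text \<open>
  A partition counted by \<open>N_durfee \<nu> n\<close> with Durfee height \<open>t\<close> is cut below its \<open>t\<close>-th part.
  The upper piece consists of \<open>t\<close> parts \<open>\<ge> t + \<nu>\<close> and contributes \<open>q^(t(t+\<nu>)) / (q;q)_t\<close>;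
  the lower piece consists of parts \<open>< t + \<nu>\<close> among which \<open>1, \<dots>, \<nu> - 1\<close> all occur and
  contributes \<open>q^(\<nu>(\<nu>-1)/2) / (q;q)_(t+\<nu>-1)\<close>. The parts of the upper piece exceed \<open>\<nu> - 1\<close>, so the
  two pieces are independent. Both generating functions come from recursions of the form
  \<open>(1 - q^m) F_m = F_(m-1)\<close>, obtained by removing a copy of the part \<open>m\<close> (lower piece) or by
  lowering all parts by one (upper piece).
\<close>

unbundle fps_syntax

section \<open>Generating functions of sets of lists\<close>

text \<open>\<open>card\<close> is 0 on infinite sets, so sums and products of
  \<open>list_gf\<close> reflect unions and concatenations only when each level is finite.\<close>

definition finite_levels :: "nat list set \<Rightarrow> bool" where
  "finite_levels A \<longleftrightarrow> (\<forall>n. finite {xs \<in> A. sum_list xs = n})"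

definition list_gf :: "nat list set \<Rightarrow> rat fps" where
  "list_gf A = Abs_fps (\<lambda>n. of_nat (card {xs \<in> A. sum_list xs = n}))"

lemma finite_levels_subset: "finite_levels B \<Longrightarrow> A \<subseteq> B \<Longrightarrow> finite_levels A"
  unfolding finite_levels_def
  by (auto elim!: finite_subset[rotated] spec)

lemma list_gf_Un:
  assumes "finite_levels A" "finite_levels B" "A \<inter> B = {}"
  shows "list_gf (A \<union> B) = list_gf A + list_gf B"
proof (rule fps_ext)
  fix n
  have eq: "{xs \<in> A \<union> B. sum_list xs = n} = {xs \<in> A. sum_list xs = n} \<union> {xs \<in> B. sum_list xs = n}"
    by blast
  have "card {xs \<in> A \<union> B. sum_list xs = n}
      = card {xs \<in> A. sum_list xs = n} + card {xs \<in> B. sum_list xs = n}"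
    unfolding eq by (rule card_Un_disjoint) (use assms in \<open>auto simp: finite_levels_def\<close>)
  then show "list_gf (A \<union> B) $ n = (list_gf A + list_gf B) $ n"
    by (simp add: list_gf_def)
qed

lemma list_gf_image_shift:
  assumes inj: "inj_on f A" and shift: "\<And>xs. xs \<in> A \<Longrightarrow> sum_list (f xs) = sum_list xs + c"
  shows "list_gf (f ` A) = fps_X ^ c * list_gf A"
proof (rule fps_ext)
  fix n
  have "card {xs \<in> f ` A. sum_list xs = n} = (if n < c then 0 else card {xs \<in> A. sum_list xs = n - c})"
  proof (cases "n < c")
    case True
    then have "{xs \<in> f ` A. sum_list xs = n} = {}"
      using shift by auto
    with True show ?thesis by (simp only: card.empty if_True)
  next
    case False
    then have "{xs \<in> f ` A. sum_list xs = n} = f ` {xs \<in> A. sum_list xs = n - c}"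
      using shift by force
    moreover have "inj_on f {xs \<in> A. sum_list xs = n - c}"
      using inj by (rule inj_on_subset) auto
    ultimately show ?thesis
      using False by (simp add: card_image)
  qed
  then show "list_gf (f ` A) $ n = (fps_X ^ c * list_gf A) $ n"
    by (simp add: list_gf_def fps_X_power_mult_nth)
qed

text \<open>The fixed length \<open>t\<close> of the first factor makes the cut point recoverable,
  so concatenation is injective. Level n of the image then splits by the sum i of the first piece,
  which is the Cauchy product.\<close>

lemma list_gf_append:
  assumes len: "\<And>xs. xs \<in> A \<Longrightarrow> length xs = t" and fin: "finite_levels A" "finite_levels B"
  shows "list_gf ((\<lambda>(xs, ys). xs @ ys) ` (A \<times> B)) = list_gf A * list_gf B"
proof (rule fps_ext)
  fix n
  let ?f = "\<lambda>(xs, ys). xs @ ys :: nat list"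
  let ?L = "\<lambda>C i. {xs \<in> C. sum_list xs = (i :: nat)}"
  have inj: "inj_on ?f (A \<times> B)"
    using len by (auto simp: inj_on_def)
  have "?L (?f ` (A \<times> B)) n = ?f ` (\<Union>i\<in>{0..n}. ?L A i \<times> ?L B (n - i))"
  proof (intro equalityI subsetI)
    fix zs assume "zs \<in> ?L (?f ` (A \<times> B)) n"
    then obtain xs ys where "zs = xs @ ys" "xs \<in> A" "ys \<in> B" "sum_list xs + sum_list ys = n"
      by auto
    then show "zs \<in> ?f ` (\<Union>i\<in>{0..n}. ?L A i \<times> ?L B (n - i))"
      by (intro image_eqI[of _ _ "(xs, ys)"]) auto
  qed auto
  moreover have "inj_on ?f (\<Union>i\<in>{0..n}. ?L A i \<times> ?L B (n - i))"
    using inj by (rule inj_on_subset) auto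
  ultimately have "card (?L (?f ` (A \<times> B)) n) = card (\<Union>i\<in>{0..n}. ?L A i \<times> ?L B (n - i))"
    by (simp add: card_image)
  also have "\<dots> = (\<Sum>i=0..n. card (?L A i \<times> ?L B (n - i)))"
    by (rule card_UN_disjoint) (use fin in \<open>auto simp: finite_levels_def\<close>)
  also have "\<dots> = (\<Sum>i=0..n. card (?L A i) * card (?L B (n - i)))"
    by (simp add: card_cartesian_product)
  finally show "list_gf (?f ` (A \<times> B)) $ n = (list_gf A * list_gf B) $ n"
    by (simp add: list_gf_def fps_mult_nth)
qed

section \<open>The part above and the part below the Durfee rectangle\<close>

text \<open>Zero entries are allowed when \<open>a = 0\<close>: \<open>long_parts t 0\<close>
  encodes the partitions into at most \<open>t\<close> parts, padded with zeros to length
  \<open>t\<close>.\<close>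

definition long_parts :: "nat \<Rightarrow> nat \<Rightarrow> nat list set" where
  "long_parts t a = {xs. sorted_wrt (\<ge>) xs \<and> length xs = t \<and> (\<forall>x\<in>set xs. a \<le> x)}"

text \<open>The bounds \<open>k\<close> and \<open>m\<close> are separate so that \<open>m\<close>
  can grow by induction while the required parts stay fixed; the application takes
  \<open>k = \<nu> - 1\<close> and \<open>m = t + \<nu> - 1\<close>.\<close>

definition short_parts :: "nat \<Rightarrow> nat \<Rightarrow> nat list set" where
  "short_parts k m = {xs. sorted_wrt (\<ge>) xs \<and> set xs \<subseteq> {1..m} \<and> {1..k} \<subseteq> set xs}"

lemma finite_levels_long_parts: "finite_levels (long_parts t a)"
  unfolding finite_levels_def
proof
  fix n
  have "{xs \<in> long_parts t a. sum_list xs = n} \<subseteq> {xs. set xs \<subseteq> {..n} \<and> length xs = t}"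
    by (auto simp: long_parts_def member_le_sum_list)
  then show "finite {xs \<in> long_parts t a. sum_list xs = n}"
    by (rule finite_subset) (simp add: finite_lists_length_eq)
qed

lemma length_le_sum_list:
  fixes xs :: "nat list"
  assumes "\<forall>x\<in>set xs. 0 < x"
  shows "length xs \<le> sum_list xs"
  using assms by (induction xs) auto

lemma finite_levels_positive: "finite_levels {xs. \<forall>x\<in>set xs. 0 < x}"
  unfolding finite_levels_def
proof
  fix n
  have "{xs \<in> {xs. \<forall>x\<in>set xs. 0 < x}. sum_list xs = n} \<subseteq> {xs. set xs \<subseteq> {..n} \<and> length xs \<le> n}"
    by (auto simp: length_le_sum_list member_le_sum_list)
  then show "finite {xs \<in> {xs. \<forall>x\<in>set xs. 0 < (x::nat)}. sum_list xs = n}"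
    by (rule finite_subset) (simp add: finite_lists_length_le)
qed

lemma finite_levels_short_parts: "finite_levels (short_parts k m)"
  by (rule finite_levels_subset[OF finite_levels_positive]) (force simp: short_parts_def)

lemma q_pochhammer_Suc: "q_pochhammer q q (Suc n) = q_pochhammer q q n * (1 - q ^ Suc n)"
  by (simp add: q_pochhammer_def)

section \<open>Generating function of the upper piece\<close>

lemma list_gf_long_parts_shift: "list_gf (long_parts t a) = fps_X ^ (t * a) * list_gf (long_parts t 0)"
proof -
  have "long_parts t a = map (\<lambda>x. x + a) ` long_parts t 0" (is "_ = ?f ` _")
  proof (intro equalityI subsetI)
    fix xs assume xs: "xs \<in> long_parts t a"
    \<comment> \<open>Truncated subtraction loses nothing here, since every entry is at least
      \<open>a\<close>.\<close>
    let ?ys = "map (\<lambda>x. x - a) xs"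
    have "xs = ?f ?ys"
      using xs by (auto simp: long_parts_def intro!: map_idI[symmetric])
    moreover have "?ys \<in> long_parts t 0"
      using xs by (auto simp: long_parts_def sorted_wrt_map diff_le_mono elim!: sorted_wrt_mono_rel[rotated])
    ultimately show "xs \<in> ?f ` long_parts t 0" by blast
  qed (auto simp: long_parts_def sorted_wrt_map)
  moreover have "list_gf (?f ` long_parts t 0) = fps_X ^ (t * a) * list_gf (long_parts t 0)"
  proof (rule list_gf_image_shift)
    show "inj_on ?f (long_parts t 0)"
      by (rule inj_on_subset[OF inj_mapI]) (auto simp: inj_def)
  qed (auto simp: long_parts_def sum_list_addf sum_list_triv)
  ultimately show ?thesis by simp
qed

text \<open>By the shift it suffices to take \<open>a = 0\<close>. A list of length t + 1 either
  ends in 0, which is deleted, or has all entries at least 1, and these are lowered. Hence F_(t+1) =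
  F_t + q^(t+1) F_(t+1).\<close>

lemma list_gf_long_parts:
  "list_gf (long_parts t a) * q_pochhammer fps_X fps_X t = fps_X ^ (t * a)"
proof -
  have "list_gf (long_parts t 0) * q_pochhammer fps_X fps_X t = 1"
  proof (induction t)
    case 0
    have "{xs \<in> long_parts 0 0. sum_list xs = n} = (if n = 0 then {[]} else {})" for n
      by (auto simp: long_parts_def)
    then show ?case
      by (intro fps_ext) (simp add: list_gf_def q_pochhammer_def)
  next
    case (Suc t)
    let ?f = "\<lambda>xs. xs @ [0 :: nat]"
    have split: "long_parts (Suc t) 0 = ?f ` long_parts t 0 \<union> long_parts (Suc t) 1"
    proof (intro equalityI subsetI)
      fix xs assume xs: "xs \<in> long_parts (Suc t) 0"
      then obtain ys y where ys: "xs = ys @ [y]"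
        by (cases xs rule: rev_cases) (auto simp: long_parts_def)
      show "xs \<in> ?f ` long_parts t 0 \<union> long_parts (Suc t) 1"
        using xs ys by (cases "y = 0") (force simp: long_parts_def sorted_wrt_append)+
    qed (auto simp: long_parts_def sorted_wrt_append)
    have "list_gf (long_parts (Suc t) 0) = list_gf (?f ` long_parts t 0) + list_gf (long_parts (Suc t) 1)"
      unfolding split
    proof (rule list_gf_Un)
      show "finite_levels (?f ` long_parts t 0)"
        \<comment> \<open>The image is one side of the decomposition \<open>split\<close>, hence a
          subset of a set already known to have finite levels.\<close>
        by (rule finite_levels_subset[OF finite_levels_long_parts[of "Suc t" 0]]) (auto simp: split)
      show "?f ` long_parts t 0 \<inter> long_parts (Suc t) 1 = {}"
        by (auto simp: long_parts_def)
    qed (rule finite_levels_long_parts)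
    also have "list_gf (?f ` long_parts t 0) = fps_X ^ 0 * list_gf (long_parts t 0)"
      by (rule list_gf_image_shift) (auto simp: inj_on_def)
    also have "list_gf (long_parts (Suc t) 1) = fps_X ^ Suc t * list_gf (long_parts (Suc t) 0)"
      by (subst list_gf_long_parts_shift) simp
    finally have "list_gf (long_parts (Suc t) 0) * (1 - fps_X ^ Suc t) = list_gf (long_parts t 0)"
      by (simp add: algebra_simps)
    then show ?case
      using Suc.IH by (metis q_pochhammer_Suc mult.assoc mult.commute)
  qed
  then show ?thesis
    by (subst list_gf_long_parts_shift) (simp only: mult.assoc mult_1_right)
qed

section \<open>Generating function of the lower piece\<close>

lemma list_gf_Cons_image: "list_gf ((#) m ` A) = fps_X ^ m * list_gf A"
  by (rule list_gf_image_shift) auto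

text \<open>As \<open>k \<le> m\<close>, the part \<open>Suc m\<close> is optional: either it is
  absent, or removing one copy leaves a list in the same set.\<close>

lemma short_parts_step:
  assumes "k \<le> m"
  shows "list_gf (short_parts k (Suc m)) * (1 - fps_X ^ Suc m) = list_gf (short_parts k m)"
proof -
  have split: "short_parts k (Suc m) = short_parts k m \<union> (#) (Suc m) ` short_parts k (Suc m)"
  proof (intro equalityI subsetI)
    fix xs assume xs: "xs \<in> short_parts k (Suc m)"
    show "xs \<in> short_parts k m \<union> (#) (Suc m) ` short_parts k (Suc m)"
    proof (cases "Suc m \<in> set xs")
      case True
      \<comment> \<open>The list is decreasing and bounded by \<open>Suc m\<close>, so an occurrence
        of \<open>Suc m\<close> forces it to be the head.\<close>
      with xs obtain ys where ys: "xs = Suc m # ys"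
        by (cases xs) (force simp: short_parts_def)+
      have "ys \<in> short_parts k (Suc m)"
        using xs ys assms by (force simp: short_parts_def)
      with ys show ?thesis by blast
    next
      case False
      with xs have "xs \<in> short_parts k m"
        by (auto simp: short_parts_def subset_iff le_Suc_eq)
      then show ?thesis by blast
    qed
  qed (auto simp: short_parts_def subset_iff)
  have "list_gf (short_parts k (Suc m))
      = list_gf (short_parts k m) + list_gf ((#) (Suc m) ` short_parts k (Suc m))"
  proof (subst split, rule list_gf_Un)
    show "finite_levels ((#) (Suc m) ` short_parts k (Suc m))"
      by (rule finite_levels_subset[OF finite_levels_short_parts[of k "Suc m"]]) (use split in blast)
    show "short_parts k m \<inter> (#) (Suc m) ` short_parts k (Suc m) = {}"
      by (auto simp: short_parts_def)
  qed (rule finite_levels_short_parts)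
  then show ?thesis
    by (simp add: list_gf_Cons_image algebra_simps)
qed

text \<open>Here the largest allowed part is itself required. Removing one copy discharges the
  requirement, but further copies may remain, so the upper bound stays \<open>Suc k\<close>.\<close>

lemma short_parts_diagonal:
  "list_gf (short_parts (Suc k) (Suc k)) = fps_X ^ Suc k * list_gf (short_parts k (Suc k))"
proof -
  have "short_parts (Suc k) (Suc k) = (#) (Suc k) ` short_parts k (Suc k)"
  proof (intro equalityI subsetI)
    fix xs assume xs: "xs \<in> short_parts (Suc k) (Suc k)"
    then have "Suc k \<in> set xs" by (auto simp: short_parts_def)
    with xs obtain ys where ys: "xs = Suc k # ys"
      by (cases xs) (force simp: short_parts_def)+
    have "ys \<in> short_parts k (Suc k)"
      using xs ys by (force simp: short_parts_def)
    with ys show "xs \<in> (#) (Suc k) ` short_parts k (Suc k)" by blast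
  qed (auto simp: short_parts_def subset_iff le_Suc_eq)
  then show ?thesis by (simp add: list_gf_Cons_image)
qed

text \<open>For each \<open>k\<close> the induction on \<open>m\<close> starts on the diagonal
  \<open>m = k\<close>, where one forced copy of \<open>k\<close> contributes q^k; these factors
  accumulate to 1 + ... + k. Every later \<open>m\<close> only adds a factor to the Pochhammer
  symbol.\<close>

lemma list_gf_short_parts:
  assumes "k \<le> m"
  shows "list_gf (short_parts k m) * q_pochhammer fps_X fps_X m = fps_X ^ (Suc k * k div 2)"
  using assms
proof (induction k arbitrary: m)
  case 0
  show ?case
  proof (induction m)
    case 0
    have "{xs \<in> short_parts 0 0. sum_list xs = n} = (if n = 0 then {[]} else {})" for n
      by (auto simp: short_parts_def)
    then show ?case
      by (intro fps_ext) (simp add: list_gf_def q_pochhammer_def)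
  next
    case (Suc m)
    then show ?case
      using short_parts_step[of 0 m] by (metis q_pochhammer_Suc mult.assoc mult.commute zero_le)
  qed
next
  case (Suc k)
  from \<open>Suc k \<le> m\<close> show ?case
  proof (induction m rule: dec_induct)
    case base
    have "Suc (Suc k) * Suc k div 2 = Suc k + Suc k * k div 2"
      by simp
    then show ?case
      using Suc.IH[of "Suc k"] by (simp add: short_parts_diagonal power_add mult.assoc)
  next
    case (step m)
    then show ?case
      using short_parts_step[of "Suc k" m] by (metis q_pochhammer_Suc mult.assoc mult.commute)
  qed
qed

section \<open>Cutting a partition at its Durfee rectangle\<close>

text \<open>For s > t the s-th part lies in \<open>ys\<close>, so it is below t + \<nu> and no
  rectangle of height s fits. Height t fits because the last entry of \<open>xs\<close>, if any, is
  at least t + \<nu>.\<close>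

lemma durfee_height_append:
  assumes "length xs = t" "\<forall>x\<in>set xs. t + \<nu> \<le> x" "\<forall>y\<in>set ys. y < t + \<nu>"
  shows "durfee_height \<nu> (xs @ ys) = t"
  unfolding durfee_height_def
proof (rule Max_eqI)
  show "finite {s. s \<le> length (xs @ ys) \<and> (s = 0 \<or> s + \<nu> \<le> (xs @ ys) ! (s - 1))}"
    by (rule finite_subset[of _ "{..length (xs @ ys)}"]) auto
next
  fix s assume s: "s \<in> {s. s \<le> length (xs @ ys) \<and> (s = 0 \<or> s + \<nu> \<le> (xs @ ys) ! (s - 1))}"
  show "s \<le> t"
  proof (rule ccontr)
    assume "\<not> s \<le> t"
    then have "(xs @ ys) ! (s - 1) = ys ! (s - 1 - t)" "s - 1 - t < length ys"
      using s assms(1) by (auto simp: nth_append)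
    then have "(xs @ ys) ! (s - 1) < t + \<nu>"
      using assms(3) by simp
    with s \<open>\<not> s \<le> t\<close> show False by auto
  qed
next
  show "t \<in> {s. s \<le> length (xs @ ys) \<and> (s = 0 \<or> s + \<nu> \<le> (xs @ ys) ! (s - 1))}"
    using assms(1,2) by (cases "t = 0") (auto simp: nth_append)
qed

lemma durfee_height_props:
  shows "durfee_height \<nu> xs \<le> length xs"
    and "durfee_height \<nu> xs = 0 \<or> durfee_height \<nu> xs + \<nu> \<le> xs ! (durfee_height \<nu> xs - 1)"
proof -
  let ?S = "{t. t \<le> length xs \<and> (t = 0 \<or> t + \<nu> \<le> xs ! (t - 1))}"
  have "finite ?S"
    by (rule finite_subset[of _ "{..length xs}"]) auto
  moreover have "0 \<in> ?S" by simp
  ultimately have "Max ?S \<in> ?S"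
    by (intro Max_in) blast+
  then show "durfee_height \<nu> xs \<le> length xs"
    and "durfee_height \<nu> xs = 0 \<or> durfee_height \<nu> xs + \<nu> \<le> xs ! (durfee_height \<nu> xs - 1)"
    by (auto simp: durfee_height_def)
qed

text \<open>For \<open>\<nu> \<ge> 1\<close> these turn out to be the partitions, of any size, that
  are counted and have Durfee height \<open>t\<close>.\<close>

definition durfee_slice :: "nat \<Rightarrow> nat \<Rightarrow> nat list set" where
  "durfee_slice \<nu> t = (\<lambda>(xs, ys). xs @ ys) ` (long_parts t (t + \<nu>) \<times> short_parts (\<nu> - 1) (t + \<nu> - 1))"

lemma durfee_height_slice:
  assumes "1 \<le> \<nu>" "xs \<in> durfee_slice \<nu> t"
  shows "durfee_height \<nu> xs = t"
proof -
  obtain ys zs where xs: "xs = ys @ zs" and ys: "ys \<in> long_parts t (t + \<nu>)"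
    and zs: "zs \<in> short_parts (\<nu> - 1) (t + \<nu> - 1)"
    using assms(2) by (auto simp: durfee_slice_def)
  show ?thesis
    unfolding xs
  proof (rule durfee_height_append)
    show "length ys = t" "\<forall>y\<in>set ys. t + \<nu> \<le> y"
      using ys by (auto simp: long_parts_def)
    show "\<forall>z\<in>set zs. z < t + \<nu>"
      using zs assms(1) by (auto simp: short_parts_def dest!: subsetD)
  qed
qed

lemma durfee_partitions_eq_slices:
  assumes \<nu>: "1 \<le> \<nu>"
  shows "{xs. is_partition_of xs n \<and> (\<forall>j. 1 \<le> j \<and> j < \<nu> \<longrightarrow> j \<in> set xs) \<and>
     (\<forall>i. durfee_height \<nu> xs \<le> i \<and> i < length xs \<longrightarrow> xs ! i < durfee_height \<nu> xs + \<nu>)}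
   = (\<Union>t. {xs \<in> durfee_slice \<nu> t. sum_list xs = n})" (is "?L = ?R")
proof (intro equalityI subsetI)
  fix zs assume zs: "zs \<in> ?L"
  define t where "t = durfee_height \<nu> zs"
  have sorted: "sorted_wrt (\<ge>) zs" and pos: "\<forall>x\<in>set zs. 0 < x" and sum: "sum_list zs = n"
    and all: "\<And>j. 1 \<le> j \<Longrightarrow> j < \<nu> \<Longrightarrow> j \<in> set zs"
    and below: "\<And>i. t \<le> i \<Longrightarrow> i < length zs \<Longrightarrow> zs ! i < t + \<nu>"
    using zs by (auto simp: is_partition_of_def t_def)
  have t: "t \<le> length zs" "t = 0 \<or> t + \<nu> \<le> zs ! (t - 1)"
    using durfee_height_props[of \<nu> zs] by (auto simp: t_def)
  have upper: "t + \<nu> \<le> x" if x: "x \<in> set (take t zs)" for x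
  proof -
    from x t(1) obtain i where i: "i < t" "x = zs ! i"
      by (auto simp: in_set_conv_nth)
    \<comment> \<open>The definition of the height bounds only the t-th part; monotonicity passes
      the bound to the earlier ones.\<close>
    have "zs ! (t - 1) \<le> zs ! i"
    proof (cases "i = t - 1")
      case False
      with i t(1) show ?thesis
        using sorted_wrt_nth_less[OF sorted, of i "t - 1"] by simp
    qed simp
    with t(2) i show ?thesis by simp
  qed
  have lower: "x < t + \<nu>" if x: "x \<in> set (drop t zs)" for x
    using x below by (auto simp: in_set_conv_nth)
  have "take t zs \<in> long_parts t (t + \<nu>)"
    using upper t(1) sorted by (auto simp: long_parts_def sorted_wrt_take)
  moreover have "drop t zs \<in> short_parts (\<nu> - 1) (t + \<nu> - 1)"
  proof -
    have "set (drop t zs) \<subseteq> {1..t + \<nu> - 1}"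
      using lower pos by (force dest: in_set_dropD)
    moreover have "{1..\<nu> - 1} \<subseteq> set (drop t zs)"
    proof
      fix j assume j: "j \<in> {1..\<nu> - 1}"
      then have "j \<in> set (take t zs) \<union> set (drop t zs)"
        unfolding set_append[symmetric] append_take_drop_id using all[of j] \<nu> by auto
      \<comment> \<open>A required part is below \<nu>, whereas upper parts are at least t +
        \<nu>.\<close>
      moreover have "j \<notin> set (take t zs)"
        using upper[of j] j \<nu> by auto
      ultimately show "j \<in> set (drop t zs)" by auto
    qed
    ultimately show ?thesis
      using sorted by (simp add: short_parts_def sorted_wrt_drop)
  qed
  ultimately have "zs \<in> durfee_slice \<nu> t"
    unfolding durfee_slice_def by (intro image_eqI[of _ _ "(take t zs, drop t zs)"]) auto
  with sum show "zs \<in> ?R" by auto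
next
  fix zs assume "zs \<in> ?R"
  then obtain t where slice: "zs \<in> durfee_slice \<nu> t" and sum: "sum_list zs = n"
    by auto
  from slice obtain xs ys where zs: "zs = xs @ ys"
    and xs: "sorted_wrt (\<ge>) xs" "length xs = t" "\<forall>x\<in>set xs. t + \<nu> \<le> x"
    and ys: "sorted_wrt (\<ge>) ys" "set ys \<subseteq> {1..t + \<nu> - 1}" "{1..\<nu> - 1} \<subseteq> set ys"
    by (auto simp: durfee_slice_def long_parts_def short_parts_def)
  have small: "1 \<le> y \<and> y < t + \<nu>" if "y \<in> set ys" for y
    using that ys(2) \<nu> by force
  have "is_partition_of zs n"
    unfolding is_partition_of_def zs sorted_wrt_append
  proof (intro conjI ballI)
    fix x y assume "x \<in> set xs" "y \<in> set ys"
    then show "y \<le> x"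
      using xs(3) small[of y] by fastforce
  next
    fix x assume "x \<in> set (xs @ ys)"
    then show "0 < x"
      using xs(3) small[of x] \<nu> by fastforce
  qed (use xs ys sum zs in simp_all)
  moreover have "\<forall>j. 1 \<le> j \<and> j < \<nu> \<longrightarrow> j \<in> set zs"
    using ys(3) by (auto simp: zs subset_iff)
  moreover have "\<forall>i. t \<le> i \<and> i < length zs \<longrightarrow> zs ! i < t + \<nu>"
    using small xs(2) by (auto simp: zs nth_append)
  ultimately show "zs \<in> ?L"
    using durfee_height_slice[OF \<nu> slice] by auto
qed

section \<open>Counting by disjoint slices\<close>

lemma finite_levels_slice:
  assumes "1 \<le> \<nu>"
  shows "finite_levels (durfee_slice \<nu> t)"
proof (rule finite_levels_subset[OF finite_levels_positive])
  have "\<forall>x\<in>set (ys @ zs). 0 < x"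
    if "ys \<in> long_parts t (t + \<nu>)" "zs \<in> short_parts (\<nu> - 1) (t + \<nu> - 1)" for ys zs
    using that assms by (auto simp: long_parts_def short_parts_def dest!: subsetD bspec)
  then show "durfee_slice \<nu> t \<subseteq> {xs. \<forall>x\<in>set xs. 0 < x}"
    by (auto simp: durfee_slice_def)
qed

text \<open>A slice of height t has t positive upper parts. Thus only the slices with t \<le> n
  contribute to degree n, and the union over all heights becomes finite.\<close>

lemma le_sum_list_slice:
  assumes "1 \<le> \<nu>" "xs \<in> durfee_slice \<nu> t"
  shows "t \<le> sum_list xs"
proof -
  obtain ys zs where "xs = ys @ zs" "length ys = t" "\<forall>x\<in>set ys. t + \<nu> \<le> x"
    using assms(2) by (auto simp: durfee_slice_def long_parts_def)
  then show ?thesis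
    using length_le_sum_list[of ys] assms(1) by force
qed

lemma N_durfee_eq_sum_slices:
  assumes "1 \<le> \<nu>"
  shows "of_nat (N_durfee \<nu> n) = (\<Sum>t\<le>n. list_gf (durfee_slice \<nu> t) $ n)"
proof -
  let ?L = "\<lambda>t. {xs \<in> durfee_slice \<nu> t. sum_list xs = n}"
  have "(\<Union>t. ?L t) = (\<Union>t\<le>n. ?L t)"
    using le_sum_list_slice[OF assms] by auto
  then have "N_durfee \<nu> n = card (\<Union>t\<le>n. ?L t)"
    unfolding N_durfee_def durfee_partitions_eq_slices[OF assms] by simp
  also have "\<dots> = (\<Sum>t\<le>n. card (?L t))"
  proof (rule card_UN_disjoint)
    show "\<forall>t\<in>{..n}. finite (?L t)"
      using finite_levels_slice[OF assms] by (simp add: finite_levels_def)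
    show "\<forall>t\<in>{..n}. \<forall>s\<in>{..n}. t \<noteq> s \<longrightarrow> ?L t \<inter> ?L s = {}"
      using durfee_height_slice[OF assms] by blast
  qed simp
  finally show ?thesis
    by (simp add: list_gf_def)
qed

section \<open>The generating function\<close>

text \<open>Convergence of formal power series is coefficientwise, and the n-th coefficient of the
  partial sums is constant once N > n.\<close>

lemma fps_sums_nth_eq_0:
  fixes f :: "nat \<Rightarrow> 'a::comm_ring_1 fps"
  assumes "\<And>t n. n < t \<Longrightarrow> f t $ n = 0"
  shows "f sums Abs_fps (\<lambda>n. \<Sum>t\<le>n. f t $ n)"
  unfolding sums_def
proof (rule tendsto_fpsI)
  fix n
  show "\<forall>\<^sub>F N in sequentially. (\<Sum>t<N. f t) $ n = Abs_fps (\<lambda>n. \<Sum>t\<le>n. f t $ n) $ n"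
    using eventually_gt_at_top[of n]
  proof eventually_elim
    case (elim N)
    then have "(\<Sum>t<N. f t $ n) = (\<Sum>t\<le>n. f t $ n)"
      by (intro sum.mono_neutral_right) (auto simp: assms)
    then show ?case by (simp add: fps_sum_nth)
  qed
qed

lemma q_pochhammer_fps_X_nth_0: "q_pochhammer fps_X fps_X n $ 0 = (1 :: 'a::comm_ring_1)"
  by (induction n) (simp_all add: q_pochhammer_def)

theorem theorem1p2:
  fixes \<nu> :: nat
  assumes "1 \<le> \<nu>"
  shows "summable (\<lambda>\<tau>. fps_X ^ (\<tau> * (\<nu> + \<tau>)) /
            (q_pochhammer fps_X fps_X \<tau> * q_pochhammer fps_X fps_X (\<nu> + \<tau> - 1)) :: rat fps) \<and>
         (Abs_fps (\<lambda>n. of_nat (N_durfee \<nu> n)) :: rat fps) =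
           fps_X ^ (\<nu> * (\<nu> - 1) div 2) *
           (\<Sum>\<tau>. fps_X ^ (\<tau> * (\<nu> + \<tau>)) /
              (q_pochhammer fps_X fps_X \<tau> * q_pochhammer fps_X fps_X (\<nu> + \<tau> - 1)))"
proof -
  define d :: "nat \<Rightarrow> rat fps" where
    "d \<tau> = q_pochhammer fps_X fps_X \<tau> * q_pochhammer fps_X fps_X (\<nu> + \<tau> - 1)" for \<tau>
  define f :: "nat \<Rightarrow> rat fps" where "f \<tau> = fps_X ^ (\<tau> * (\<nu> + \<tau>)) / d \<tau>" for \<tau>
  define c where "c = \<nu> * (\<nu> - 1) div 2"
  \<comment> \<open>A nonzero constant term makes \<open>d \<tau>\<close> a unit, so the division
    becomes multiplication by an inverse.\<close>
  have d0: "d \<tau> $ 0 \<noteq> 0" for \<tau>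
    by (simp add: d_def q_pochhammer_fps_X_nth_0)
  have f_eq: "f \<tau> = fps_X ^ (\<tau> * (\<nu> + \<tau>)) * inverse (d \<tau>)" for \<tau>
    by (simp add: f_def fps_divide_unit d0)
  have f0: "f \<tau> $ n = 0" if "n < \<tau>" for \<tau> n
  proof -
    \<comment> \<open>Since \<nu> \<ge> 1, the exponent \<tau>(\<nu> + \<tau>) is at least
      \<tau>.\<close>
    have "n < \<tau> * (\<nu> + \<tau>)"
      using that assms by (simp add: less_le_trans)
    then show ?thesis by (simp add: f_eq fps_X_power_mult_nth)
  qed
  have sums: "f sums Abs_fps (\<lambda>n. \<Sum>\<tau>\<le>n. f \<tau> $ n)"
    by (rule fps_sums_nth_eq_0) (rule f0)
  have slice: "list_gf (durfee_slice \<nu> \<tau>) = fps_X ^ c * f \<tau>" for \<tau>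
  proof -
    have "list_gf (durfee_slice \<nu> \<tau>)
        = list_gf (long_parts \<tau> (\<tau> + \<nu>)) * list_gf (short_parts (\<nu> - 1) (\<tau> + \<nu> - 1))"
      unfolding durfee_slice_def
      by (rule list_gf_append[OF _ finite_levels_long_parts finite_levels_short_parts])
        (simp add: long_parts_def)
    then have "list_gf (durfee_slice \<nu> \<tau>) * d \<tau>
        = (list_gf (long_parts \<tau> (\<tau> + \<nu>)) * q_pochhammer fps_X fps_X \<tau>) *
          (list_gf (short_parts (\<nu> - 1) (\<tau> + \<nu> - 1)) * q_pochhammer fps_X fps_X (\<tau> + \<nu> - 1))"
      by (simp add: d_def ac_simps)
    also have "\<dots> = fps_X ^ (\<tau> * (\<tau> + \<nu>)) * fps_X ^ c"
      using assms by (simp add: list_gf_long_parts list_gf_short_parts c_def)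
    finally have "list_gf (durfee_slice \<nu> \<tau>) * (d \<tau> * inverse (d \<tau>))
        = fps_X ^ (\<tau> * (\<tau> + \<nu>)) * fps_X ^ c * inverse (d \<tau>)"
      by (simp add: mult.assoc[symmetric])
    then show ?thesis
      by (simp add: f_eq inverse_mult_eq_1'[OF d0] ac_simps)
  qed
  have "Abs_fps (\<lambda>n. of_nat (N_durfee \<nu> n)) = fps_X ^ c * Abs_fps (\<lambda>n. \<Sum>\<tau>\<le>n. f \<tau> $ n)"
  proof (rule fps_ext)
    fix n
    have "(\<Sum>\<tau>\<le>n. (fps_X ^ c * f \<tau>) $ n) = (if n < c then 0 else \<Sum>\<tau>\<le>n. f \<tau> $ (n - c))"
      by (simp add: fps_X_power_mult_nth)
    \<comment> \<open>The terms with n - c < \<tau> \<le> n vanish by \<open>f0\<close>, which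
      matches the summation range to the shifted coefficient.\<close>
    also have "\<dots> = (if n < c then 0 else \<Sum>\<tau>\<le>n - c. f \<tau> $ (n - c))"
      by (auto intro!: sum.mono_neutral_right f0)
    finally show "Abs_fps (\<lambda>n. of_nat (N_durfee \<nu> n)) $ n
        = (fps_X ^ c * Abs_fps (\<lambda>n. \<Sum>\<tau>\<le>n. f \<tau> $ n)) $ n"
      by (simp add: N_durfee_eq_sum_slices[OF assms] slice fps_X_power_mult_nth)
  qed
  then have "summable f \<and> Abs_fps (\<lambda>n. of_nat (N_durfee \<nu> n)) = fps_X ^ c * suminf f"
    using sums_summable[OF sums] sums_unique[OF sums] by simp
  then show ?thesis
    unfolding f_def d_def c_def .
qed

end
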